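(* Let $k$ be a real closed field and $\mathbb P$ the field of Puiseux series over $k$. Then $v\text{-}\mathrm{Aut}\,\mathbb P=v\text{-}\mathrm{Aut}^{+}\,\mathbb P$, i.e. every valuation preserving automorphism of $\mathbb P$ is strongly additive.
   Context: $k((\mathbb Q))$ is the field of formal series $a=\sum_{q\in\mathbb Q}a_qt^q$ ($a_q\in k$) with well ordered support $\operatorname{supp}a=\{q:a_q\ne0\}$, with termwise addition and convolution product. $\mathbb P\subseteq k((\mathbb Q))$ is the subfield of series of the form $\sum_{n\ge m}a_nt^{n/n_a}$ with $m\in\mathbb Z$ and $n_a$ a positive integer depending on $a$. Its valuation is $v(a)=\min\operatorname{supp}a$ for $a\neq0$, $v(0)=\infty$, with value group $\mathbb Q$. $v\text{-}\mathrm{Aut}\,\mathbb P$ is the group of field automorphisms $\sigma$ of $\mathbb P$ for which there is an order preserving automorphism $\tau$ of $(\mathbb Q,+)$ with $\tau(v(a))=v(\sigma(a))$ for all $a\in\mathbb P^\times$. A family $\{a_{(i)}\}_{i\in I}\subseteq k((\mathbb Q))$ is summable if $\bigcup_i\operatorname{supp}a_{(i)}$ is well ordered and each $g\in\mathbb Q$ lies in $\operatorname{supp}a_{(i)}$ for only finitely many $i$; its sum is then $\sum_g\big(\sum_i(a_{(i)})_g\big)t^g$. It is $\mathbb P$-summable if it is a summable family of elements of $\mathbb P$ whose sum lies in $\mathbb P$. A map $\sigma\colon\mathbb P\to\mathbb P$ is $\mathbb P$-summable if for every $a=\sum a_gt^g\in\mathbb P$ the family $\{\sigma(a_gt^g):g\in\operatorname{supp}a\}$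 is $\mathbb P$-summable with sum $\sigma(a)$. $\sigma\in v\text{-}\mathrm{Aut}\,\mathbb P$ is strongly additive if both $\sigma$ and $\sigma^{-1}$ are $\mathbb P$-summable, and $v\text{-}\mathrm{Aut}^{+}\,\mathbb P$ is the set of strongly additive elements of $v\text{-}\mathrm{Aut}\,\mathbb P$. *)

theory Defs
  imports Complex_Main "HOL-Algebra.QuotRing" "HOL-Library.FuncSet" "HOL-Library.Extended"
begin

text \<open>
  The order of a real closed field is determined by its field structure (the positive elements are
  the nonzero squares), so having it in the class does not restrict the field. As in the class
  \<open>alg_closed_field\<close>, polynomials are written as explicit sums.
\<close>

class real_closed_field = linordered_field +
  assumes nonneg_imp_square: "0 \<le> x \<Longrightarrow> \<exists>y. x = y ^ 2"
    and odd_degree_imp_root: "odd n \<Longrightarrow> f n \<noteq> 0 \<Longrightarrow> \<exists>x. (\<Sum>i\<le>n. f i * x ^ i) = 0"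

definition well_ordered :: "'a::linorder set \<Rightarrow> bool" where
  "well_ordered S \<longleftrightarrow> well_order_on S {(x, y). x \<in> S \<and> y \<in> S \<and> x \<le> y}"

lemma well_ordered_iff_least:
  "well_ordered S \<longleftrightarrow> (\<forall>T\<subseteq>S. T \<noteq> {} \<longrightarrow> (\<exists>m\<in>T. \<forall>x\<in>T. m \<le> x))"
proof -
  define s where "s = {(x, y). x \<in> S \<and> y \<in> S \<and> x < y}"
  have lin: "linear_order_on S {(x, y). x \<in> S \<and> y \<in> S \<and> x \<le> y}"
    by (auto simp: order_on_defs refl_on_def trans_def antisym_def total_on_def)
  have "{(x, y). x \<in> S \<and> y \<in> S \<and> x \<le> y} - Id = s"
    unfolding s_def by auto
  then have "well_ordered S \<longleftrightarrow> wf s"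
    using lin unfolding well_ordered_def well_order_on_def by simp
  also have "\<dots> \<longleftrightarrow> (\<forall>T\<subseteq>S. T \<noteq> {} \<longrightarrow> (\<exists>m\<in>T. \<forall>x\<in>T. m \<le> x))" (is "_ \<longleftrightarrow> ?R")
  proof
    assume wf: "wf s"
    show ?R
    proof (intro allI impI)
      fix T assume T: "T \<subseteq> S" "T \<noteq> {}"
      then obtain a where "a \<in> T" by blast
      then obtain m where m: "m \<in> T" "\<And>y. (y, m) \<in> s \<Longrightarrow> y \<notin> T"
        using wfE_min[OF wf, of a T] by metis
      have "m \<le> x" if "x \<in> T" for x
      proof (rule leI, rule notI)
        assume "x < m"
        then have "(x, m) \<in> s" using T(1) m(1) that unfolding s_def by auto
        then show False using m(2) that by simp
      qed
      then show "\<exists>m\<in>T. \<forall>x\<in>T. m \<le> x" using m(1) by auto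
    qed
  next
    assume R: ?R
    show "wf s"
    proof (rule wfI_min)
      fix x :: 'a and Q assume x: "x \<in> Q"
      show "\<exists>z\<in>Q. \<forall>y. (y, z) \<in> s \<longrightarrow> y \<notin> Q"
      proof (cases "Q \<inter> S = {}")
        case True
        then show ?thesis using x unfolding s_def by auto
      next
        case False
        then obtain m where m: "m \<in> Q \<inter> S" "\<forall>x\<in>Q \<inter> S. m \<le> x"
          using R[rule_format, of "Q \<inter> S"] by auto
        then have "y \<notin> Q" if "(y, m) \<in> s" for y
          using that unfolding s_def by (metis (no_types, lifting) CollectD IntI case_prodD leD)
        then show ?thesis using m(1) by auto
      qed
    qed
  qed
  finally show ?thesis .
qed

text \<open>A formal series is represented by its coefficient function.\<close>

type_synonym 'k series = "rat \<Rightarrow> 'k"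

definition supp :: "'k::zero series \<Rightarrow> rat set" where
  "supp a = {q. a q \<noteq> 0}"

definition hahn :: "'k::zero series set" where
  "hahn = {a. well_ordered (supp a)}"

definition term_series :: "'k::zero \<Rightarrow> rat \<Rightarrow> 'k series" where
  "term_series c g = (\<lambda>q. if q = g then c else 0)"

text \<open>
  The index set of the convolution sum is finite whenever both supports are well ordered.
\<close>

definition conv :: "'k::semiring_0 series \<Rightarrow> 'k series \<Rightarrow> 'k series" where
  "conv a b = (\<lambda>q. \<Sum>p\<in>{p \<in> supp a. q - p \<in> supp b}. a p * b (q - p))"

definition hahn_ring :: "'k::field series ring" where
  "hahn_ring = \<lparr>carrier = hahn, mult = conv, one = term_series 1 0,
     zero = (\<lambda>q. 0), add = (\<lambda>a b q. a q + b q)\<rparr>"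

definition puiseux :: "'k::zero series set" where
  "puiseux = {a \<in> hahn. \<exists>(m::int) (d::nat). d > 0 \<and>
     supp a \<subseteq> {of_int n / of_nat d | n. n \<ge> m}}"

definition puiseux_ring :: "'k::field series ring" where
  "puiseux_ring = hahn_ring\<lparr>carrier := puiseux\<rparr>"

definition val :: "'k::zero series \<Rightarrow> rat extended" where
  "val a = (if supp a = {} then \<infinity> else Fin (LEAST q. q \<in> supp a))"

definition ordered_group_aut :: "(rat \<Rightarrow> rat) \<Rightarrow> bool" where
  "ordered_group_aut \<tau> \<longleftrightarrow> bij \<tau> \<and> (\<forall>x y. \<tau> (x + y) = \<tau> x + \<tau> y) \<and> mono \<tau>"

text \<open>
  A map on the Puiseux series is a HOL function on all series that is \<open>undefined\<close> off
  \<open>puiseux\<close>; hence equality of such functions is equality of the maps.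
\<close>

definition vAut :: "('k::field series \<Rightarrow> 'k series) set" where
  "vAut = {\<sigma> \<in> ring_iso puiseux_ring puiseux_ring \<inter> extensional puiseux.
     \<exists>\<tau>. ordered_group_aut \<tau> \<and>
       (\<forall>a \<in> puiseux - {\<zero>\<^bsub>puiseux_ring\<^esub>}. val (\<sigma> a) = map_extended \<tau> (val a))}"

definition summable_family :: "'i set \<Rightarrow> ('i \<Rightarrow> 'k::zero series) \<Rightarrow> bool" where
  "summable_family I F \<longleftrightarrow> F \<in> I \<rightarrow> hahn \<and> well_ordered (\<Union>i\<in>I. supp (F i)) \<and>
     (\<forall>g. finite {i \<in> I. g \<in> supp (F i)})"

definition family_sum :: "'i set \<Rightarrow> ('i \<Rightarrow> 'k::comm_monoid_add series) \<Rightarrow> 'k series" where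
  "family_sum I F = (\<lambda>g. \<Sum>i\<in>{i \<in> I. g \<in> supp (F i)}. F i g)"

definition P_summable_family :: "'i set \<Rightarrow> ('i \<Rightarrow> 'k::comm_monoid_add series) \<Rightarrow> bool" where
  "P_summable_family I F \<longleftrightarrow> F \<in> I \<rightarrow> puiseux \<and> summable_family I F \<and> family_sum I F \<in> puiseux"

definition P_summable_map :: "('k::comm_monoid_add series \<Rightarrow> 'k series) \<Rightarrow> bool" where
  "P_summable_map \<sigma> \<longleftrightarrow> \<sigma> \<in> puiseux \<rightarrow> puiseux \<and>
     (\<forall>a\<in>puiseux. P_summable_family (supp a) (\<lambda>g. \<sigma> (term_series (a g) g)) \<and>
        family_sum (supp a) (\<lambda>g. \<sigma> (term_series (a g) g)) = \<sigma> a)"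

definition vAut_plus :: "('k::field series \<Rightarrow> 'k series) set" where
  "vAut_plus = {\<sigma> \<in> vAut. P_summable_map \<sigma> \<and> P_summable_map (restrict (inv_into puiseux \<sigma>) puiseux)}"

end

theory Submission
  imports Defs
begin

text \<open>
  The support of a Puiseux series has only finitely many elements below any bound, so the series is
  the limit, in the valuation topology, of its truncations, which are finite sums of monomials.
  A map \<open>\<sigma>\<close> that moves valuations by an order automorphism \<open>\<tau>\<close> of \<open>\<rat>\<close> is continuous for this
  topology, because \<open>\<tau>\<close> has no upper bound. If \<open>\<sigma>\<close> is also additive, then \<open>\<sigma> a\<close> is the
  limit of the finite sums of the \<open>\<sigma> (a\<^sub>g t\<^sup>g)\<close>. The valuations \<open>\<tau> g\<close> of these images exceed any given
  bound for all but finitely many \<open>g\<close> in the support of \<open>a\<close>. Hence only finitely many images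
  contribute to each coefficient, and the union of their supports is again finite below every
  bound, in particular well ordered. The sum is \<open>\<sigma> a\<close>, so it is a Puiseux series; this gives the
  bound on its denominators without any comparison of the denominators of the images.

  This is \<open>additive_valuation_shift_P_summable\<close>. It applies to an automorphism and also to its
  inverse, whose valuations are moved by the inverse of \<open>\<tau>\<close>.
\<close>

section \<open>Puiseux series and finiteness of their supports\<close>

definition finite_below :: "'a::linorder set \<Rightarrow> bool" where
  "finite_below S \<longleftrightarrow> (\<forall>N. finite {x \<in> S. x < N})"

lemma finite_below_imp_well_ordered:
  assumes "finite_below S"
  shows "well_ordered S"
  unfolding well_ordered_iff_least
proof (intro allI impI)
  fix T assume T: "T \<subseteq> S" "T \<noteq> {}"
  then obtain a where a: "a \<in> T" by blast
  let ?L = "{x \<in> T. x < a}"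
  have fin: "finite ?L"
    by (rule finite_subset[of _ "{x \<in> S. x < a}"]) (use assms T in \<open>auto simp: finite_below_def\<close>)
  show "\<exists>m\<in>T. \<forall>x\<in>T. m \<le> x"
  proof (cases "?L = {}")
    case True
    then show ?thesis using a by (auto intro!: bexI[of _ a])
  next
    case False
    then have "Min ?L \<in> ?L" using fin by (rule Min_in[rotated])
    moreover have "Min ?L \<le> x" if "x \<in> T" for x
    proof (cases "x < a")
      case True
      then show ?thesis using fin that by simp
    next
      case False
      then show ?thesis using \<open>Min ?L \<in> ?L\<close> by auto
    qed
    ultimately show ?thesis by blast
  qed
qed

lemma finite_below_subset:
  assumes "finite_below T" "S \<subseteq> T"
  shows "finite_below S"
  unfolding finite_below_def
proof
  fix N
  have "finite {x \<in> T. x < N}" using assms(1) by (simp add: finite_below_def)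
  then show "finite {x \<in> S. x < N}" by (rule rev_finite_subset) (use assms(2) in auto)
qed

definition fractions_from :: "int \<Rightarrow> nat \<Rightarrow> rat set" where
  "fractions_from m d = {of_int n / of_nat d | n. n \<ge> m}"

lemma finite_below_fractions_from:
  assumes "d > 0"
  shows "finite_below (fractions_from m d)"
  unfolding finite_below_def
proof
  fix N :: rat
  have "{x \<in> fractions_from m d. x < N} \<subseteq> (\<lambda>n. of_int n / of_nat d) ` {m..\<lceil>N * of_nat d\<rceil>}"
  proof
    fix x assume "x \<in> {x \<in> fractions_from m d. x < N}"
    then obtain n where n: "x = of_int n / of_nat d" "n \<ge> m" "x < N"
      by (auto simp: fractions_from_def)
    then have "of_int n < N * of_nat d" using assms by (simp add: pos_divide_less_eq)
    then have "n \<le> \<lceil>N * of_nat d\<rceil>" by linarith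
    then show "x \<in> (\<lambda>n. of_int n / of_nat d) ` {m..\<lceil>N * of_nat d\<rceil>}" using n by auto
  qed
  then show "finite {x \<in> fractions_from m d. x < N}"
    by (rule finite_subset) simp
qed

lemma fractions_from_refine:
  assumes "e > 0" "l \<le> m * int e"
  shows "fractions_from m d \<subseteq> fractions_from l (d * e)"
proof
  fix x assume "x \<in> fractions_from m d"
  then obtain n where n: "x = of_int n / of_nat d" "n \<ge> m" by (auto simp: fractions_from_def)
  have "x = of_int (n * int e) / of_nat (d * e)" using n assms(1) by simp
  moreover have "l \<le> n * int e"
    using assms(2) mult_right_mono[OF n(2), of "int e"] by simp
  ultimately show "x \<in> fractions_from l (d * e)" unfolding fractions_from_def by blast
qed

text \<open>
  An exponent set with a common denominator and a lower bound is automatically well ordered.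
\<close>

lemma puiseux_iff:
  "a \<in> puiseux \<longleftrightarrow> (\<exists>m d. d > 0 \<and> supp a \<subseteq> fractions_from m d)"
proof -
  have "a \<in> hahn" if "d > 0" "supp a \<subseteq> fractions_from m d" for m d
    using finite_below_subset[OF finite_below_fractions_from[OF that(1)] that(2)]
    by (simp add: hahn_def finite_below_imp_well_ordered)
  then show ?thesis unfolding puiseux_def mem_Collect_eq fractions_from_def[symmetric] by blast
qed

lemma puiseux_finite_below_supp: "a \<in> puiseux \<Longrightarrow> finite_below (supp a)"
  using finite_below_subset[OF finite_below_fractions_from] by (auto simp: puiseux_iff)

lemma puiseux_supp_subset: "a \<in> puiseux \<Longrightarrow> supp b \<subseteq> supp a \<Longrightarrow> b \<in> puiseux"
  unfolding puiseux_iff by blast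

lemma puiseux_zero: "(\<lambda>q. 0) \<in> puiseux"
  unfolding puiseux_iff by (auto simp: supp_def intro!: exI[of _ "1::nat"])

lemma puiseux_add:
  fixes a b :: "'k::monoid_add series"
  assumes "a \<in> puiseux" "b \<in> puiseux"
  shows "(\<lambda>q. a q + b q) \<in> puiseux"
proof -
  obtain m d where a: "d > 0" "supp a \<subseteq> fractions_from m d"
    using assms(1) unfolding puiseux_iff by blast
  obtain l e where b: "e > 0" "supp b \<subseteq> fractions_from l e"
    using assms(2) unfolding puiseux_iff by blast
  let ?j = "min (m * int e) (l * int d)"
  have "supp a \<subseteq> fractions_from ?j (d * e)"
    using a(2) fractions_from_refine[OF b(1), of ?j m d] by simp
  moreover have "supp b \<subseteq> fractions_from ?j (d * e)"
    using b(2) fractions_from_refine[OF a(1), of ?j l e] by (simp add: mult.commute)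
  moreover have "supp (\<lambda>q. a q + b q) \<subseteq> supp a \<union> supp b" by (auto simp: supp_def)
  ultimately have "supp (\<lambda>q. a q + b q) \<subseteq> fractions_from ?j (d * e)" by blast
  moreover have "d * e > 0" using a(1) b(1) by simp
  ultimately show ?thesis unfolding puiseux_iff by blast
qed

section \<open>Additive maps that shift the valuation\<close>

lemma hahn_val_eq_Fin:
  assumes "a \<in> hahn" "val a = Fin m"
  shows "m \<in> supp a" "supp a \<subseteq> {m..}"
proof -
  from assms(2) have ne: "supp a \<noteq> {}" and m: "m = (LEAST q. q \<in> supp a)"
    by (auto simp: val_def split: if_splits)
  obtain l where l: "l \<in> supp a" "\<forall>x\<in>supp a. l \<le> x"
    using assms(1) ne unfolding hahn_def well_ordered_iff_least by auto
  have "m = l" unfolding m by (rule Least_equality) (use l in auto)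
  with l show "m \<in> supp a" "supp a \<subseteq> {m..}" by auto
qed

lemma valuation_shift_supp:
  assumes "mono \<tau>" "a \<in> puiseux" "\<sigma> a \<in> puiseux" "\<sigma> (\<lambda>q. 0) = (\<lambda>q. 0)"
    and shift: "a \<noteq> (\<lambda>q. 0) \<Longrightarrow> val (\<sigma> a) = map_extended \<tau> (val a)"
    and low: "supp a \<subseteq> {g..}"
  shows "supp (\<sigma> a) \<subseteq> {\<tau> g..}"
proof (cases "a = (\<lambda>q. 0)")
  case True
  then show ?thesis using assms(4) by (simp add: supp_def)
next
  case False
  then have "supp a \<noteq> {}" by (auto simp: supp_def fun_eq_iff)
  then obtain m where m: "val a = Fin m" by (auto simp: val_def)
  have "a \<in> hahn" "\<sigma> a \<in> hahn" using assms(2,3) by (auto simp: puiseux_def)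
  then have "g \<le> m" "supp (\<sigma> a) \<subseteq> {\<tau> m..}"
    using hahn_val_eq_Fin(1)[of a m] hahn_val_eq_Fin(2)[of "\<sigma> a" "\<tau> m"] m low shift[OF False] by auto
  then show ?thesis using monoD[OF assms(1), of g m] by fastforce
qed

definition puiseux_additive :: "('k::monoid_add series \<Rightarrow> 'k series) \<Rightarrow> bool" where
  "puiseux_additive \<sigma> \<longleftrightarrow>
     (\<forall>a\<in>puiseux. \<forall>b\<in>puiseux. \<sigma> (\<lambda>q. a q + b q) = (\<lambda>q. \<sigma> a q + \<sigma> b q))"

lemma puiseux_additiveD:
  "puiseux_additive \<sigma> \<Longrightarrow> a \<in> puiseux \<Longrightarrow> b \<in> puiseux
    \<Longrightarrow> \<sigma> (\<lambda>q. a q + b q) = (\<lambda>q. \<sigma> a q + \<sigma> b q)"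
  unfolding puiseux_additive_def by blast

lemma additive_zero:
  fixes \<sigma> :: "'k::ab_group_add series \<Rightarrow> 'k series"
  assumes "puiseux_additive \<sigma>"
  shows "\<sigma> (\<lambda>q. 0) = (\<lambda>q. 0)"
proof
  fix x
  have "\<sigma> (\<lambda>q. 0) = (\<lambda>q. \<sigma> (\<lambda>q. 0) q + \<sigma> (\<lambda>q. 0) q)"
    by (rule puiseux_additiveD[OF assms puiseux_zero puiseux_zero, unfolded add_0_right])
  then have "\<sigma> (\<lambda>q. 0) x = \<sigma> (\<lambda>q. 0) x + \<sigma> (\<lambda>q. 0) x"
    by (rule fun_cong)
  then show "\<sigma> (\<lambda>q. 0) x = 0"
    by (rule add_cancel_right_right[THEN iffD1])
qed

lemma additive_finite_truncation:
  fixes \<sigma> :: "'k::ab_group_add series \<Rightarrow> 'k series"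
  assumes add: "puiseux_additive \<sigma>"
    and a: "a \<in> puiseux" and fin: "finite A"
  shows "\<sigma> (\<lambda>q. if q \<in> A then a q else 0) = (\<lambda>q. \<Sum>g\<in>A. \<sigma> (term_series (a g) g) q)"
  using fin
proof (induction A rule: finite_induct)
  case empty
  then show ?case using additive_zero[OF add] by simp
next
  case (insert x A)
  have "(\<lambda>q. if q \<in> insert x A then a q else 0)
    = (\<lambda>q. term_series (a x) x q + (if q \<in> A then a q else 0))"
    using insert.hyps by (auto simp: term_series_def fun_eq_iff)
  moreover have "term_series (a x) x \<in> puiseux" "(\<lambda>q. if q \<in> A then a q else 0) \<in> puiseux"
    by (rule puiseux_supp_subset[OF a], auto simp: supp_def term_series_def split: if_splits)+
  ultimately show ?case using insert puiseux_additiveD[OF add] by simp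
qed

text \<open>
  Additivity reaches only finite sums of monomials. To compute the coefficient of \<open>\<sigma> a\<close> at \<open>q\<close>, cut
  \<open>a\<close> at an exponent \<open>N\<close> with \<open>\<tau> N > q\<close>: the tail starts at \<open>N\<close> or later, so its image does
  not reach \<open>q\<close>, and what remains is a finite sum.
\<close>

lemma additive_valuation_shift_P_summable:
  fixes \<sigma> :: "'k::ab_group_add series \<Rightarrow> 'k series"
  assumes maps: "\<sigma> \<in> puiseux \<rightarrow> puiseux"
    and add: "puiseux_additive \<sigma>"
    and tau: "bij \<tau>" "mono \<tau>"
    and shift: "\<And>a. a \<in> puiseux \<Longrightarrow> a \<noteq> (\<lambda>q. 0) \<Longrightarrow> val (\<sigma> a) = map_extended \<tau> (val a)"
  shows "P_summable_map \<sigma>"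
  unfolding P_summable_map_def
proof (intro conjI ballI)
  show "\<sigma> \<in> puiseux \<rightarrow> puiseux" by (rule maps)
next
  fix a :: "'k series" assume a: "a \<in> puiseux"
  define F where "F = (\<lambda>g. \<sigma> (term_series (a g) g))"
  have low: "supp (\<sigma> b) \<subseteq> {\<tau> g..}" if "b \<in> puiseux" "supp b \<subseteq> {g..}" for b g
    using valuation_shift_supp[of \<tau> b \<sigma> g] tau maps that additive_zero[OF add] shift by blast
  have mon: "term_series (a g) g \<in> puiseux" for g
    by (rule puiseux_supp_subset[OF a]) (auto simp: supp_def term_series_def split: if_splits)
  have F_puiseux: "F g \<in> puiseux" for g
    unfolding F_def using maps mon by auto
  have F_low: "supp (F g) \<subseteq> {\<tau> g..}" for g
    unfolding F_def by (rule low[OF mon]) (auto simp: supp_def term_series_def split: if_splits)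
  have cutoff: "\<exists>N. q < \<tau> N" for q :: rat
    using bij_is_surj[OF tau(1)] by (metis lt_ex gt_ex surjD)
  have fin: "finite {g \<in> supp a. g < N}" for N
    using puiseux_finite_below_supp[OF a] by (simp add: finite_below_def)
  have F_reach: "g < N" if "q \<in> supp (F g)" "q < \<tau> N" for N g q
  proof (rule ccontr)
    assume "\<not> g < N"
    then have "\<tau> N \<le> \<tau> g" by (simp add: monoD[OF tau(2)])
    moreover have "\<tau> g \<le> q" using F_low that(1) by auto
    ultimately show False using that(2) by simp
  qed
  have fin_contrib: "finite {g \<in> supp a. q \<in> supp (F g)}" for q
  proof -
    obtain N where N: "q < \<tau> N" using cutoff by blast
    have "{g \<in> supp a. q \<in> supp (F g)} \<subseteq> {g \<in> supp a. g < N}"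
      using F_reach[OF _ N] by blast
    then show ?thesis using fin finite_subset by blast
  qed
  have "finite_below (\<Union>g\<in>supp a. supp (F g))"
    unfolding finite_below_def
  proof
    fix q :: rat
    obtain N where N: "q < \<tau> N" using cutoff by blast
    have "{x \<in> \<Union>g\<in>supp a. supp (F g). x < q}
      \<subseteq> (\<Union>g\<in>{g \<in> supp a. g < N}. {x \<in> supp (F g). x < q})"
    proof
      fix x assume "x \<in> {x \<in> \<Union>g\<in>supp a. supp (F g). x < q}"
      then obtain g where g: "g \<in> supp a" "x \<in> supp (F g)" "x < q" by blast
      have "g < N" using F_reach[OF g(2), of N] g(3) N by simp
      then show "x \<in> (\<Union>g\<in>{g \<in> supp a. g < N}. {x \<in> supp (F g). x < q})" using g by blast
    qed
    moreover have "finite {x \<in> supp (F g). x < q}" for g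
      using puiseux_finite_below_supp[OF F_puiseux] by (simp add: finite_below_def)
    ultimately show "finite {x \<in> \<Union>g\<in>supp a. supp (F g). x < q}"
      using fin by (meson finite_UN_I finite_subset)
  qed
  then have summable: "summable_family (supp a) F"
    using F_puiseux fin_contrib finite_below_imp_well_ordered
    by (auto simp: summable_family_def puiseux_def)
  show sum: "family_sum (supp a) (\<lambda>g. \<sigma> (term_series (a g) g)) = \<sigma> a"
    unfolding F_def[symmetric]
  proof
    fix q
    obtain N where N: "q < \<tau> N" using cutoff by blast
    define A where "A = {g \<in> supp a. g < N}"
    define r where "r = (\<lambda>x. if x < N then 0 else a x)"
    have r: "r \<in> puiseux"
      by (rule puiseux_supp_subset[OF a]) (auto simp: supp_def r_def)
    have trunc: "(\<lambda>x. if x \<in> A then a x else 0) \<in> puiseux"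
      by (rule puiseux_supp_subset[OF a]) (auto simp: supp_def)
    have "(\<lambda>x. (if x \<in> A then a x else 0) + r x) = a"
      by (auto simp: A_def r_def supp_def)
    then have "\<sigma> a = (\<lambda>q. \<sigma> (\<lambda>x. if x \<in> A then a x else 0) q + \<sigma> r q)"
      using puiseux_additiveD[OF add trunc r] by (simp only:)
    moreover have "\<sigma> r q = 0"
    proof -
      have "supp (\<sigma> r) \<subseteq> {\<tau> N..}"
        by (rule low[OF r]) (auto simp: r_def supp_def)
      then show ?thesis using N by (force simp: supp_def)
    qed
    ultimately have "\<sigma> a q = (\<Sum>g\<in>A. F g q)"
      using additive_finite_truncation[OF add a, of A] fin[of N]
      by (simp add: A_def F_def)
    also have "\<dots> = family_sum (supp a) F q"
      unfolding family_sum_def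
    proof (rule sum.mono_neutral_right)
      show "finite A" unfolding A_def by (rule fin)
      show "{g \<in> supp a. q \<in> supp (F g)} \<subseteq> A"
        using F_reach[OF _ N] by (auto simp: A_def)
    qed (auto simp: A_def supp_def)
    finally show "family_sum (supp a) F q = \<sigma> a q" by simp
  qed
  show "P_summable_family (supp a) (\<lambda>g. \<sigma> (term_series (a g) g))"
    unfolding P_summable_family_def using summable F_puiseux sum maps a
    by (auto simp: F_def)
qed

section \<open>Automorphisms and their inverses\<close>

lemma mono_inv_of_bij:
  fixes \<tau> :: "'a::linorder \<Rightarrow> 'b::linorder"
  assumes "bij \<tau>" "mono \<tau>"
  shows "mono (inv_into UNIV \<tau>)"
proof (rule monoI, rule ccontr)
  fix x y :: 'b assume "x \<le> y" and "\<not> inv_into UNIV \<tau> x \<le> inv_into UNIV \<tau> y"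
  then have lt: "inv_into UNIV \<tau> y < inv_into UNIV \<tau> x" by simp
  then have "\<tau> (inv_into UNIV \<tau> y) \<le> \<tau> (inv_into UNIV \<tau> x)" using assms(2) by (simp add: monoD)
  then have "x = y" using \<open>x \<le> y\<close> assms(1) by (simp add: bij_is_surj surj_f_inv_f)
  with lt show False by simp
qed

theorem proposition5p5p1:
  shows "(vAut :: ('k::real_closed_field series \<Rightarrow> 'k series) set) = vAut_plus"
proof -
  have "P_summable_map \<sigma> \<and> P_summable_map (restrict (inv_into puiseux \<sigma>) puiseux)"
    if mem: "\<sigma> \<in> vAut" for \<sigma> :: "'k series \<Rightarrow> 'k series"
  proof -
    have iso: "\<sigma> \<in> ring_iso puiseux_ring puiseux_ring" using mem by (simp add: vAut_def)
    obtain \<tau> where tau: "bij \<tau>" "mono \<tau>"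
      and shift_ball: "\<forall>a \<in> puiseux - {\<zero>\<^bsub>puiseux_ring\<^esub>}. val (\<sigma> a) = map_extended \<tau> (val a)"
      using mem unfolding vAut_def ordered_group_aut_def by blast
    have shift: "val (\<sigma> a) = map_extended \<tau> (val a)" if "a \<in> puiseux" "a \<noteq> (\<lambda>q. 0)" for a
      using shift_ball that by (simp add: puiseux_ring_def hahn_ring_def)
    have bij: "bij_betw \<sigma> puiseux puiseux"
      using iso by (simp add: ring_iso_def puiseux_ring_def)
    then have maps: "\<sigma> \<in> puiseux \<rightarrow> puiseux" by (auto simp: bij_betw_def)
    have add: "puiseux_additive \<sigma>"
      using iso by (auto simp: puiseux_additive_def ring_iso_def ring_hom_def puiseux_ring_def hahn_ring_def)
    define \<rho> where "\<rho> = restrict (inv_into puiseux \<sigma>) puiseux"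
    have rho_mem: "\<rho> b \<in> puiseux" and sigma_rho: "\<sigma> (\<rho> b) = b" if "b \<in> puiseux" for b
      using bij that by (auto simp: \<rho>_def bij_betw_def inv_into_into f_inv_into_f)
    have rho_sigma: "\<rho> (\<sigma> a) = a" if "a \<in> puiseux" for a
      using bij maps that by (auto simp: \<rho>_def bij_betw_def inv_into_f_f)
    have "P_summable_map \<rho>"
    proof (rule additive_valuation_shift_P_summable)
      show "\<rho> \<in> puiseux \<rightarrow> puiseux" using rho_mem by blast
      show "bij (inv_into UNIV \<tau>)" using tau(1) by (rule bij_imp_bij_inv)
      show "mono (inv_into UNIV \<tau>)" using tau by (rule mono_inv_of_bij)
    next
      show "puiseux_additive \<rho>"
        unfolding puiseux_additive_def
      proof (intro ballI)
        fix a b :: "'k series" assume ab: "a \<in> puiseux" "b \<in> puiseux"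
        have "\<sigma> (\<lambda>q. \<rho> a q + \<rho> b q) = (\<lambda>q. a q + b q)"
          using puiseux_additiveD[OF add rho_mem rho_mem] ab by (simp add: sigma_rho)
        then show "\<rho> (\<lambda>q. a q + b q) = (\<lambda>q. \<rho> a q + \<rho> b q)"
          using rho_sigma[OF puiseux_add[OF rho_mem[OF ab(1)] rho_mem[OF ab(2)]]] by simp
      qed
    next
      fix a :: "'k series" assume a: "a \<in> puiseux" "a \<noteq> (\<lambda>q. 0)"
      have "\<rho> a \<noteq> (\<lambda>q. 0)"
        using a sigma_rho additive_zero[OF add] by metis
      then have "val a = map_extended \<tau> (val (\<rho> a))"
        using shift[OF rho_mem[OF a(1)]] sigma_rho[OF a(1)] by simp
      then show "val (\<rho> a) = map_extended (inv_into UNIV \<tau>) (val a)"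
        using tau(1) by (simp add: extended.map_comp extended.map_id0 bij_is_inj)
    qed
    moreover have "P_summable_map \<sigma>"
      using maps add tau shift by (rule additive_valuation_shift_P_summable)
    ultimately show ?thesis unfolding \<rho>_def by blast
  qed
  then show ?thesis unfolding vAut_plus_def by blast
qed

end
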